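(* Let $1\le d\le m-1$ be integers. For any real $m\times m$ matrix $A\in M(\mathbb{R}^m)$, let $A^s=\frac12(A+A')$, where $A'$ is the transpose of $A$, and let $\lambda_1(A^s)\ge\dots\ge\lambda_m(A^s)$ be the eigenvalues of $A^s$ in decreasing order. Then the distance (for the Frobenius norm) from $A$ to the medial axis of the Grassmannian $\mathcal{G}_d(\mathbb{R}^m)\subset M(\mathbb{R}^m)$ is $$\mathrm{dist}\big(A,\mathrm{med}(\mathcal{G}_d(\mathbb{R}^m))\big)=\frac{\sqrt2}{2}\,\big|\lambda_d(A^s)-\lambda_{d+1}(A^s)\big|.$$ If this distance is positive, the projection of $A$ on $\mathcal{G}_d(\mathbb{R}^m)$ is described as follows: write $A^s=ODO'$ with $O$ an orthogonal matrix and $D$ the diagonal matrix containing the eigenvalues of $A^s$ in decreasing order, and let $J_d$ be the diagonal matrix whose first $d$ diagonal terms are $1$ and whose other terms are $0$; then $$\mathrm{proj}\big(A,\mathcal{G}_d(\mathbb{R}^m)\big)=OJ_dO'.$$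
   Context: $M(\mathbb{R}^m)$ is the space of real $m\times m$ matrices with the Frobenius norm $\|\cdot\|_F$. The Grassmannian $\mathcal{G}_d(\mathbb{R}^m)$ of $d$-dimensional linear subspaces of $\mathbb{R}^m$ is identified with the subset of $M(\mathbb{R}^m)$ consisting of the orthogonal projection matrices of rank $d$. For a subset $S$, $\mathrm{dist}(A,S)=\inf_{B\in S}\|A-B\|_F$. The medial axis $\mathrm{med}(\mathcal{G}_d(\mathbb{R}^m))$ is the set of $A\in M(\mathbb{R}^m)$ for which there exist two distinct $P,P'\in\mathcal{G}_d(\mathbb{R}^m)$ with $\|A-P\|_F=\|A-P'\|_F=\mathrm{dist}(A,\mathcal{G}_d(\mathbb{R}^m))$. For $A\notin\mathrm{med}(\mathcal{G}_d(\mathbb{R}^m))$, $\mathrm{proj}(A,\mathcal{G}_d(\mathbb{R}^m))$ is the unique $P\in\mathcal{G}_d(\mathbb{R}^m)$ with $\|A-P\|_F=\mathrm{dist}(A,\mathcal{G}_d(\mathbb{R}^m))$. *)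

theory Defs
  imports "HOL-Analysis.Analysis" "HOL-Computational_Algebra.Computational_Algebra"
begin

text \<open>
  The space of real m by m matrices is \<open>real ^ 'm ^ 'm\<close>, with \<open>m = CARD('m)\<close>. Its library norm is
  the Frobenius norm, as the following lemma records, so \<open>dist\<close> and \<open>infdist\<close> are the Frobenius
  distances. The index type is linearly ordered so that ``the first d diagonal terms'' makes sense.
\<close>

lemma norm_matrix_eq_Frobenius:
  fixes A :: "real ^ 'n ^ 'm"
  shows "norm A = sqrt (\<Sum>i\<in>UNIV. \<Sum>j\<in>UNIV. (A $ i $ j)\<^sup>2)"
  by (simp add: norm_vec_def L2_set_def sum_nonneg)

definition medial_axis :: "'a::metric_space set \<Rightarrow> 'a set" where
  "medial_axis S = {a. \<exists>p\<in>S. \<exists>p'\<in>S. p \<noteq> p' \<and> dist a p = infdist a S \<and> dist a p' = infdist a S}"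

text \<open>Meaningful only when there is exactly one nearest point.\<close>

definition proj_onto :: "'a::metric_space \<Rightarrow> 'a set \<Rightarrow> 'a" where
  "proj_onto a S = (THE p. p \<in> S \<and> dist a p = infdist a S)"

text \<open>A matrix is an orthogonal projection (onto its range) iff it is idempotent and symmetric.\<close>

definition grassmannian :: "nat \<Rightarrow> (real ^ 'm ^ 'm) set" where
  "grassmannian d = {P. P ** P = P \<and> transpose P = P \<and> rank P = d}"

definition sym_part :: "real ^ 'm ^ 'm \<Rightarrow> real ^ 'm ^ 'm" where
  "sym_part A = (1/2) *\<^sub>R (A + transpose A)"

text \<open>The polynomial \<open>det (X I - A)\<close>, as a determinant over the polynomial ring.\<close>

definition charpoly :: "real ^ 'm ^ 'm \<Rightarrow> real poly" where
  "charpoly A = det (\<chi> i j. (if i = j then [:0, 1:] else 0) - [:A $ i $ j:])"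

text \<open>
  \<open>eigval A k\<close> is the \<open>k\<close>-th largest real eigenvalue of \<open>A\<close>, counted with multiplicity and starting
  from \<open>k = 1\<close>. It is only meaningful if \<open>A\<close> has at least \<open>k\<close> real eigenvalues, as is the case for
  symmetric \<open>A\<close> and \<open>1 \<le> k \<le> m\<close>.
\<close>

definition eigval :: "real ^ 'm ^ 'm \<Rightarrow> nat \<Rightarrow> real" where
  "eigval A k = rev (sorted_list_of_multiset (proots (charpoly A))) ! (k - 1)"

text \<open>The position of an index, counted from 1.\<close>

definition pos :: "'m::{finite,linorder} \<Rightarrow> nat" where
  "pos i = card {j. j \<le> i}"

definition eigval_diag :: "real ^ 'm::{finite,linorder} ^ 'm::{finite,linorder} \<Rightarrow> real ^ 'm::{finite,linorder} ^ 'm::{finite,linorder}" where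
  "eigval_diag A = (\<chi> i j. if i = j then eigval A (pos i) else 0)"

definition J_mat :: "nat \<Rightarrow> real ^ 'm::{finite,linorder} ^ 'm::{finite,linorder}" where
  "J_mat d = (\<chi> i j. if i = j \<and> pos i \<le> d then 1 else 0)"

end

theory Submission
  imports Defs "HOL-Combinatorics.Permutations"
begin

text \<open>
  All \<open>P\<close> in the Grassmannian have the same norm, so the points nearest to \<open>A\<close> are the maximisers of
  \<open>S \<bullet> P\<close>, where \<open>S\<close> is the symmetric part of \<open>A\<close>. If \<open>S = Q D Q'\<close>, then \<open>S \<bullet> P\<close> is the sum of the
  \<open>D\<^sub>i\<^sub>i R\<^sub>i\<^sub>i\<close> with \<open>R = Q' P Q\<close>, whose diagonal entries lie in \<open>[0, 1]\<close> and sum to \<open>d\<close>. So \<open>Q J\<^sub>d Q'\<close> is a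
  maximiser, it is the only one if \<open>\<lambda>\<^sub>d > \<lambda>\<^sub>d\<^sub>+\<^sub>1\<close>, and for \<open>\<lambda>\<^sub>d = \<lambda>\<^sub>d\<^sub>+\<^sub>1\<close> exchanging the indices \<open>d\<close> and
  \<open>d + 1\<close> gives another one. Hence the medial axis is the zero set of the gap \<open>\<lambda>\<^sub>d - \<lambda>\<^sub>d\<^sub>+\<^sub>1\<close>.
  Replacing both eigenvalues by their mean closes the gap at cost \<open>(\<lambda>\<^sub>d - \<lambda>\<^sub>d\<^sub>+\<^sub>1) / \<surd>2\<close>. No shorter
  move does, because the gap is \<open>\<surd>2\<close>-Lipschitz: it is compared for \<open>S\<close> and \<open>T\<close> through
  \<open>(S - T) \<bullet> (u u' - v v')\<close> for suitable orthogonal unit vectors \<open>u\<close>, \<open>v\<close>, and \<open>u u' - v v'\<close> has norm \<open>\<surd>2\<close>.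
\<close>

no_notation fps_nth (infixl "$" 75)

section \<open>Diagonalization of symmetric matrices\<close>

text \<open>The entry type is arbitrary because the same notion serves for real matrices and, in the
  computation of the characteristic polynomial, for polynomial ones.\<close>

definition diag_mat :: "('n::finite \<Rightarrow> 'a::zero) \<Rightarrow> 'a ^ 'n ^ 'n" where
  "diag_mat e = (\<chi> i j. if i = j then e i else 0)"

lemma diag_conj_nth:
  fixes Q :: "'a::comm_semiring_1 ^ 'n ^ 'n"
  shows "(Q ** diag_mat e ** transpose Q) $ i $ j = (\<Sum>k\<in>UNIV. Q $ i $ k * e k * Q $ j $ k)"
  by (simp add: matrix_matrix_mult_def diag_mat_def transpose_def if_distrib [of "\<lambda>x. _ * x"] cong: if_cong)

lemma transpose_diag_conj:
  fixes Q :: "'a::comm_semiring_1 ^ 'n ^ 'n"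
  shows "transpose (Q ** diag_mat e ** transpose Q) = Q ** diag_mat e ** transpose Q"
  by (simp add: vec_eq_iff transpose_def[of "_ ** _"] diag_conj_nth mult_ac)

lemma symmetric_matrix_inner:
  fixes S :: "real ^ 'n ^ 'n"
  assumes "transpose S = S"
  shows "x \<bullet> (S *v y) = (S *v x) \<bullet> y"
  by (metis assms dot_lmul_matrix transpose_matrix_vector)

text \<open>For small \<open>t\<close> the linear term dominates, and its sign changes with that of
  \<open>t\<close>. This is the first-order condition at an extremum.\<close>

lemma linear_coeff_zero_if_quadratic_nonneg:
  fixes a b :: real
  assumes "\<And>t. 0 \<le> t * a + t\<^sup>2 * b"
  shows "a = 0"
proof (rule ccontr)
  assume a: "a \<noteq> 0"
  \<comment> \<open>Any nonzero \<open>t\<close> of sign opposite to \<open>a\<close> with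
    \<open>\<bar>t\<bar> * \<bar>b\<bar> < \<bar>a\<bar>\<close> makes the expression negative; the
    summand 1 covers \<open>b = 0\<close>.\<close>
  define t where "t = - a / (1 + \<bar>b\<bar>)"
  have "t * a + t\<^sup>2 * b = a\<^sup>2 / (1 + \<bar>b\<bar>)\<^sup>2 * (b - (1 + \<bar>b\<bar>))"
    by (simp add: t_def divide_simps power2_eq_square add_eq_0_iff) (auto simp: algebra_simps add_eq_0_iff)
  moreover have "\<dots> < 0"
    using a by (intro mult_pos_neg) auto
  ultimately show False using assms[of t] by simp
qed

text \<open>The quadratic form of \<open>S\<close> attains a maximum on the compact unit sphere of
  \<open>W\<close>, and a maximiser is an eigenvector because the first variation vanishes
  there.\<close>

lemma symmetric_eigenvector_in_invariant_subspace:
  fixes S :: "real ^ 'n ^ 'n"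
  assumes S: "transpose S = S" and W: "subspace W" and inv: "\<And>x. x \<in> W \<Longrightarrow> S *v x \<in> W"
    and ne: "z \<in> W" "z \<noteq> 0"
  obtains x l where "x \<in> W" "norm x = 1" "S *v x = l *\<^sub>R x"
proof -
  define K where "K = W \<inter> sphere 0 1"
  have "compact K"
    unfolding K_def using W by (simp add: closed_subspace closed_Int_compact)
  moreover have "z /\<^sub>R norm z \<in> K"
    using ne W by (auto simp: K_def subspace_scale)
  moreover have "continuous_on K (\<lambda>x. x \<bullet> (S *v x))"
    by (intro continuous_intros matrix_vector_mult_linear_continuous_on)
  ultimately obtain x where x: "x \<in> K" and max: "\<And>y. y \<in> K \<Longrightarrow> y \<bullet> (S *v y) \<le> x \<bullet> (S *v x)"
    using continuous_attains_sup[of K "\<lambda>x. x \<bullet> (S *v x)"] by blast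
  define l where "l = x \<bullet> (S *v x)"
  have xW: "x \<in> W" and nx: "norm x = 1" using x by (auto simp: K_def)
  \<comment> \<open>By homogeneity the bound extends from the unit sphere to all of
    \<open>W\<close>.\<close>
  have nn: "y \<bullet> (S *v y) \<le> l * (y \<bullet> y)" if "y \<in> W" for y
  proof (cases "y = 0")
    case False
    have "y /\<^sub>R norm y \<in> K"
      using False that W by (auto simp: K_def subspace_scale)
    from max[OF this] False show ?thesis
      by (simp add: l_def matrix_vector_mult_scaleR dot_square_norm divide_simps power2_eq_square mult_ac)
  qed simp
  \<comment> \<open>The residual of the eigenvalue equation lies in \<open>W\<close> by invariance.
    Moving from \<open>x\<close> in the direction \<open>w\<close> gives the first-order coefficient
    \<open>2 * (w \<bullet> w)\<close>, so \<open>w = 0\<close>.\<close>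
  define w where "w = l *\<^sub>R x - S *v x"
  have wW: "w \<in> W" unfolding w_def using W xW inv by (simp add: subspace_diff subspace_scale)
  have "0 \<le> t * (2 * (w \<bullet> w)) + t\<^sup>2 * (l * (w \<bullet> w) - w \<bullet> (S *v w))" for t
  proof -
    have "x + t *\<^sub>R w \<in> W" using W xW wW by (simp add: subspace_add subspace_scale)
    from nn[OF this]
    have "x \<bullet> (S *v x) + t * (w \<bullet> (S *v x)) + t * (x \<bullet> (S *v w)) + t\<^sup>2 * (w \<bullet> (S *v w))
        \<le> l * (x \<bullet> x) + l * (2 * t * (w \<bullet> x)) + l * (t\<^sup>2 * (w \<bullet> w))"
      by (simp add: matrix_vector_mult_scaleR matrix_vector_right_distrib inner_add_left inner_add_right algebra_simps power2_eq_square inner_commute)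
    moreover have "x \<bullet> (S *v w) = w \<bullet> (S *v x)"
      using symmetric_matrix_inner[OF S] by (simp add: inner_commute)
    moreover have "x \<bullet> x = 1" using nx by (simp add: dot_square_norm)
    moreover have ww: "w \<bullet> w = l * (w \<bullet> x) - w \<bullet> (S *v x)"
      by (subst (2) w_def) (simp add: inner_diff_right)
    moreover have "t * (2 * (w \<bullet> w)) = l * (2 * t * (w \<bullet> x)) - 2 * (t * (w \<bullet> (S *v x)))"
      unfolding ww by (simp add: algebra_simps)
    ultimately show ?thesis
      unfolding l_def[symmetric] right_diff_distrib by (simp add: mult_ac)
  qed
  then have "2 * (w \<bullet> w) = 0" by (rule linear_coeff_zero_if_quadratic_nonneg)
  then have "S *v x = l *\<^sub>R x" by (simp add: w_def)
  with xW nx that show thesis by blast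
qed

text \<open>A largest orthonormal set of eigenvectors spans the space: its orthogonal complement is
  invariant under \<open>S\<close>, so a nonzero complement would contain one more
  eigenvector.\<close>

theorem symmetric_matrix_diagonalization:
  fixes S :: "real ^ 'n ^ 'n"
  assumes S: "transpose S = S"
  obtains Q e where "orthogonal_matrix Q" "S = Q ** diag_mat e ** transpose Q"
proof -
  \<comment> \<open>Orthonormal sets are independent, so the size of such a \<open>T\<close> is
    bounded and a largest one exists.\<close>
  define ok where "ok T \<longleftrightarrow> pairwise orthogonal T \<and> (\<forall>x\<in>T. norm x = 1 \<and> (\<exists>l. S *v x = l *\<^sub>R x))"
    for T :: "(real ^ 'n) set"
  have ind: "independent T" if "ok T" for T
    using that by (intro pairwise_orthogonal_independent) (auto simp: ok_def)
  have "ok {}" by (simp add: ok_def)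
  moreover have "\<forall>T. ok T \<longrightarrow> card T < Suc (CARD('n))"
    using independent_bound[OF ind] by (auto simp: less_Suc_eq_le)
  ultimately obtain T where T: "ok T" and Tmax: "\<And>T'. ok T' \<Longrightarrow> card T' \<le> card T"
    using ex_has_greatest_nat[of ok "{}" card "Suc (CARD('n))"] by blast
  have finT: "finite T" using independent_bound[OF ind[OF T]] by auto
  have span: "span T = UNIV"
  proof (rule ccontr)
    assume "span T \<noteq> UNIV"
    then have "span T \<subset> span UNIV" by auto
    then obtain z where z: "z \<noteq> 0" "\<And>y. y \<in> span T \<Longrightarrow> orthogonal z y"
      using orthogonal_to_subspace_exists_gen by metis
    define W where "W = {w. \<forall>y\<in>T. orthogonal w y}"
    have "subspace W"
      unfolding W_def by (auto simp: subspace_def orthogonal_clauses)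
    moreover have "S *v w \<in> W" if "w \<in> W" for w
      unfolding W_def
    proof (intro CollectI ballI)
      fix y assume y: "y \<in> T"
      then obtain l where "S *v y = l *\<^sub>R y" using T by (auto simp: ok_def)
      then show "orthogonal (S *v w) y"
        using that y by (simp add: W_def orthogonal_def symmetric_matrix_inner[OF S, symmetric])
    qed
    moreover have "z \<in> W" using z(2) by (auto simp: W_def intro: span_base)
    ultimately obtain x l where x: "x \<in> W" "norm x = 1" "S *v x = l *\<^sub>R x"
      using symmetric_eigenvector_in_invariant_subspace[OF S] z(1) by metis
    have "x \<notin> T" using x by (auto simp: W_def orthogonal_def dot_square_norm)
    moreover have "ok (insert x T)"
      using T x by (auto simp: ok_def W_def pairwise_insert orthogonal_commute)
    ultimately show False using Tmax[of "insert x T"] finT by simp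
  qed
  have "card T = CARD('n)"
    using dim_span_eq_card_independent[OF ind[OF T]] by (simp add: span)
  then obtain q where q: "bij_betw q (UNIV :: 'n set) T"
    using finT finite_same_card_bij by (metis finite_class.finite_UNIV)
  \<comment> \<open>The eigenvectors in \<open>T\<close> become the columns of
    \<open>Q\<close>.\<close>
  define Q :: "real ^ 'n ^ 'n" where "Q = (\<chi> i j. q j $ i)"
  have "\<forall>j. \<exists>l. S *v q j = l *\<^sub>R q j" using T q by (auto simp: ok_def bij_betw_def)
  then obtain e where e: "\<And>j. S *v q j = e j *\<^sub>R q j" by metis
  have col: "column j Q = q j" for j by (simp add: Q_def column_def vec_eq_iff)
  have Q: "orthogonal_matrix Q"
    unfolding orthogonal_matrix_orthonormal_columns col
    using T q unfolding ok_def pairwise_def bij_betw_def inj_on_def by (metis UNIV_I rangeI)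
  have "S ** Q = Q ** diag_mat e"
  proof (simp add: vec_eq_iff, intro allI)
    fix i j
    have "(S ** Q) $ i $ j = (S *v q j) $ i"
      by (simp add: matrix_matrix_mult_def matrix_vector_mult_def Q_def)
    also have "\<dots> = (Q ** diag_mat e) $ i $ j"
      unfolding e by (simp add: matrix_matrix_mult_def Q_def diag_mat_def if_distrib [of "\<lambda>x. _ * x"] cong: if_cong)
    finally show "(S ** Q) $ i $ j = (Q ** diag_mat e) $ i $ j" .
  qed
  then have "S = Q ** diag_mat e ** transpose Q"
    using Q by (metis matrix_mul_assoc matrix_mul_rid orthogonal_matrix_def)
  with Q that show thesis by blast
qed

section \<open>Characteristic polynomial and ordered eigenvalues\<close>

text \<open>Read as a matrix \<open>C\<close> of constant polynomials, \<open>Q\<close> still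
  satisfies \<open>C ** transpose C = mat 1\<close>. So \<open>X I - Q D Q'\<close> equals
  \<open>C (X I - D) C'\<close>, and the determinant is multiplicative.\<close>

lemma charpoly_orthogonal_conj:
  fixes Q :: "real ^ 'n ^ 'n"
  assumes Q: "orthogonal_matrix Q"
  shows "charpoly (Q ** diag_mat e ** transpose Q) = (\<Prod>i\<in>UNIV. [:- e i, 1:])"
proof -
  define C where "C = (\<chi> i j. [:Q $ i $ j:])"
  have const_sum: "[:sum f A:] = (\<Sum>k\<in>A. [:f k:])" for f :: "'n \<Rightarrow> real" and A
  proof -
    have "[:a + b:] = [:a:] + [:b:]" for a b :: real by simp
    then show ?thesis
      by (induction A rule: infinite_finite_induct) (simp_all del: add_pCons)
  qed
  have QQ: "(\<Sum>k\<in>UNIV. Q $ i $ k * Q $ j $ k) = (if i = j then 1 else 0)" for i j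
  proof -
    have "(Q ** transpose Q) $ i $ j = (mat 1 :: real ^ 'n ^ 'n) $ i $ j"
      using Q by (simp add: orthogonal_matrix_def)
    then show ?thesis by (simp add: matrix_matrix_mult_def transpose_def mat_def)
  qed
  have CC: "C ** transpose C = mat 1"
  proof (simp add: vec_eq_iff, intro allI)
    fix i j
    have "(C ** transpose C) $ i $ j = [:\<Sum>k\<in>UNIV. Q $ i $ k * Q $ j $ k:]"
      by (simp add: matrix_matrix_mult_def transpose_def C_def const_sum mult_ac)
    also have "\<dots> = mat 1 $ i $ j"
      by (simp add: QQ mat_def)
    finally show "(C ** transpose C) $ i $ j = mat 1 $ i $ j" .
  qed
  have "(\<chi> i j. (if i = j then [:0, 1:] else 0) - [:(Q ** diag_mat e ** transpose Q) $ i $ j:])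
      = C ** diag_mat (\<lambda>i. [:- e i, 1:]) ** transpose C"
  proof (intro vec_eq_iff [THEN iffD2] allI)
    fix i j
    have "(\<Sum>k\<in>UNIV. C $ i $ k * [:- e k, 1:] * C $ j $ k)
        = (\<Sum>k\<in>UNIV. [:0, 1:] * [:Q $ i $ k * Q $ j $ k:] - [:Q $ i $ k * e k * Q $ j $ k:])"
      by (rule sum.cong) (auto simp: C_def algebra_simps)
    also have "\<dots> = [:0, 1:] * [:\<Sum>k\<in>UNIV. Q $ i $ k * Q $ j $ k:] - [:\<Sum>k\<in>UNIV. Q $ i $ k * e k * Q $ j $ k:]"
      unfolding const_sum sum_subtractf sum_distrib_left ..
    finally show "(\<chi> i j. (if i = j then [:0, 1:] else 0) - [:(Q ** diag_mat e ** transpose Q) $ i $ j:]) $ i $ j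
        = (C ** diag_mat (\<lambda>i. [:- e i, 1:]) ** transpose C) $ i $ j"
      unfolding diag_conj_nth vec_lambda_beta by (simp only: QQ) simp
  qed
  then have "charpoly (Q ** diag_mat e ** transpose Q)
      = det (C ** transpose C) * det (diag_mat (\<lambda>i. [:- e i, 1:]))"
    by (simp add: charpoly_def det_mul mult_ac)
  also have "\<dots> = (\<Prod>i\<in>UNIV. [:- e i, 1:])"
    unfolding CC by (simp add: det_diagonal diag_mat_def)
  finally show ?thesis .
qed

lemma proots_charpoly_orthogonal_conj:
  fixes Q :: "real ^ 'n ^ 'n"
  assumes "orthogonal_matrix Q"
  shows "proots (charpoly (Q ** diag_mat e ** transpose Q)) = image_mset e (mset_set UNIV)"
proof -
  have "(\<Sum>i\<in>A. {#e i#}) = image_mset e (mset_set A)" if "finite A" for A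
    using that by induction auto
  then show ?thesis
    by (simp add: charpoly_orthogonal_conj[OF assms] proots_prod)
qed

section \<open>Positions of indices and the sorted list of eigenvalues\<close>

lemma pos_strict_mono: "strict_mono (pos :: 'm::{finite,linorder} \<Rightarrow> nat)"
  by (auto simp: strict_mono_def pos_def simp flip: atMost_def intro!: psubset_card_mono)

lemma bij_betw_pos: "bij_betw pos (UNIV :: 'm::{finite,linorder} set) {1..CARD('m)}"
proof -
  have inj: "inj (pos :: 'm \<Rightarrow> nat)"
    using pos_strict_mono by (rule strict_mono_imp_inj_on)
  have "pos i \<in> {1..CARD('m)}" for i :: 'm
    unfolding pos_def by (auto simp: Suc_le_eq card_gt_0_iff intro: card_mono)
  then have "range (pos :: 'm \<Rightarrow> nat) = {1..CARD('m)}"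
    by (intro card_subset_eq) (auto simp: card_image inj)
  with inj show ?thesis by (simp add: bij_betw_def)
qed

lemma pos_bounds: "1 \<le> pos i" "pos i \<le> CARD('m)" for i :: "'m::{finite,linorder}"
  using bij_betw_pos[where 'm = 'm] by (auto simp: bij_betw_def)

text \<open>Gives the size of an index set described by positions; this yields the rank of
  \<open>J_mat d\<close> and the dimensions of the eigenspaces that are counted later.\<close>

lemma card_pos_vimage:
  assumes "K \<subseteq> {1..CARD('m)}"
  shows "card {i :: 'm::{finite,linorder}. pos i \<in> K} = card K"
  using card_vimage_inj[of pos K] bij_betw_pos assms by (auto simp: bij_betw_def vimage_def)

lemma card_pos_le:
  assumes "d \<le> CARD('m)"
  shows "card {i :: 'm::{finite,linorder}. pos i \<le> d} = d"
  using card_pos_vimage[where K = "{1..d}" and 'm = 'm] pos_bounds[where 'm = 'm] assms by simp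

text \<open>The positions run once through the whole sorted list. The hypothesis, that all
  eigenvalues are real, makes the list long enough for every position.\<close>

lemma mset_sorted_eigvals:
  fixes S :: "real ^ 'm::{finite,linorder} ^ 'm::{finite,linorder}"
  assumes "size (proots (charpoly S)) = CARD('m)"
  shows "image_mset (\<lambda>i::'m. eigval S (pos i)) (mset_set UNIV) = proots (charpoly S)"
proof -
  define L where "L = rev (sorted_list_of_multiset (proots (charpoly S)))"
  have L: "mset L = proots (charpoly S)" by (simp add: L_def)
  then have len: "length L = CARD('m)" using assms by (metis size_mset)
  have "image_mset (\<lambda>i::'m. eigval S (pos i)) (mset_set UNIV)
      = image_mset (\<lambda>k. L ! (k - 1)) (image_mset pos (mset_set (UNIV :: 'm set)))"
    by (simp add: eigval_def L_def image_mset.compositionality comp_def)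
  also have "image_mset pos (mset_set (UNIV :: 'm set)) = mset_set {1..CARD('m)}"
    using bij_betw_pos[where 'm = 'm] by (simp add: image_mset_mset_set bij_betw_def)
  \<comment> \<open>Eigenvalues are numbered from 1, list entries from 0.\<close>
  also have "\<dots> = image_mset Suc (mset_set {0..<CARD('m)})"
    by (simp add: image_mset_mset_set image_Suc_atLeastLessThan atLeastLessThanSuc_atLeastAtMost)
  also have "image_mset (\<lambda>k. L ! (k - 1)) \<dots> = mset (map ((!) L) [0..<length L])"
    by (simp add: image_mset.compositionality comp_def len)
  also have "\<dots> = proots (charpoly S)" by (simp only: map_nth L)
  finally show ?thesis .
qed

lemma eigval_diag_eq: "eigval_diag S = diag_mat (\<lambda>i. eigval S (pos i))"
  by (simp add: eigval_diag_def diag_mat_def)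

lemma J_mat_eq: "J_mat d = diag_mat (indicat_real {i. pos i \<le> d})"
  by (auto simp: J_mat_def diag_mat_def vec_eq_iff)

lemma size_proots_charpoly_symmetric:
  fixes S :: "real ^ 'm ^ 'm"
  assumes "transpose S = S"
  shows "size (proots (charpoly S)) = CARD('m)"
  by (metis assms symmetric_matrix_diagonalization proots_charpoly_orthogonal_conj
      size_image_mset size_mset_set)

lemma eigval_antimono:
  fixes S :: "real ^ 'm ^ 'm"
  assumes "transpose S = S" "1 \<le> k" "k \<le> l" "l \<le> CARD('m)"
  shows "eigval S l \<le> eigval S k"
proof -
  have "length (sorted_list_of_multiset (proots (charpoly S))) = CARD('m)"
    using size_proots_charpoly_symmetric[OF assms(1)] by (metis mset_sorted_list_of_multiset size_mset)
  then show ?thesis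
    unfolding eigval_def using assms by (intro sorted_rev_nth_mono) auto
qed

text \<open>The diagonal of any diagonalization is the multiset of roots of the characteristic
  polynomial, so permuting the columns of \<open>Q\<close> sorts it.\<close>

lemma symmetric_matrix_eigval_diagonalization:
  fixes S :: "real ^ 'm::{finite,linorder} ^ 'm::{finite,linorder}"
  assumes S: "transpose S = S"
  obtains Q where "orthogonal_matrix Q" "S = Q ** eigval_diag S ** transpose Q"
proof -
  obtain Q e where Q: "orthogonal_matrix Q" and SQ: "S = Q ** diag_mat e ** transpose Q"
    using symmetric_matrix_diagonalization[OF S] .
  have "image_mset (\<lambda>i::'m. eigval S (pos i)) (mset_set UNIV) = image_mset e (mset_set UNIV)"
    using mset_sorted_eigvals[OF size_proots_charpoly_symmetric[OF S]]
      proots_charpoly_orthogonal_conj[OF Q, of e] SQ by simp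
  then obtain p where p: "p permutes UNIV" and pe: "\<And>i. eigval S (pos i) = e (p i)"
    using image_mset_eq_implies_permutes[of UNIV "\<lambda>i::'m. eigval S (pos i)" e] by auto
  define R where "R = (\<chi> i j. Q $ i $ p j)"
  have inj: "inj p" using p by (rule permutes_inj)
  have col: "column j R = column (p j) Q" for j by (simp add: R_def column_def)
  have "orthogonal_matrix R"
    using Q inj unfolding orthogonal_matrix_orthonormal_columns col by (auto simp: inj_eq)
  moreover have "S = R ** eigval_diag S ** transpose R"
  proof (simp add: vec_eq_iff eigval_diag_eq diag_conj_nth, intro allI)
    fix i j
    have "S $ i $ j = (\<Sum>k\<in>UNIV. Q $ i $ k * e k * Q $ j $ k)"
      by (subst SQ) (rule diag_conj_nth)
    also have "\<dots> = (\<Sum>k\<in>UNIV. R $ i $ k * e (p k) * R $ j $ k)"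
      by (subst sum.permute[OF p]) (simp add: R_def)
    finally show "S $ i $ j = (\<Sum>k\<in>UNIV. R $ i $ k * eigval S (pos k) * R $ j $ k)"
      by (simp add: pe)
  qed
  ultimately show thesis by (rule that)
qed

section \<open>Nearest points of the Grassmannian\<close>

lemma inner_matrix_eq_trace: "A \<bullet> B = trace (transpose A ** B)"
  for A B :: "real ^ 'n ^ 'm"
  unfolding inner_vec_def trace_def matrix_matrix_mult_def transpose_def
  by (simp add: sum.swap[of _ UNIV "UNIV :: 'n set"])

lemma inner_transpose: "transpose A \<bullet> transpose B = A \<bullet> B"
  for A B :: "real ^ 'n ^ 'm"
  by (simp add: inner_matrix_eq_trace) (metis inner_commute inner_matrix_eq_trace trace_mul_sym transpose_transpose)

text \<open>Transposition preserves the inner product and fixes \<open>P\<close>, so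
  \<open>A\<close> and its transpose have the same inner product with \<open>P\<close>.\<close>

lemma inner_sym_part:
  fixes A P :: "real ^ 'n ^ 'n"
  assumes "transpose P = P"
  shows "sym_part A \<bullet> P = A \<bullet> P"
  using inner_transpose[of A P] by (simp add: sym_part_def inner_add_left assms)

lemma transpose_sym_part: "transpose (sym_part A) = sym_part A"
  by (simp add: sym_part_def vec_eq_iff transpose_def add.commute)

lemma orthogonal_matrix_cancel:
  fixes Q :: "real ^ 'n ^ 'n"
  assumes "orthogonal_matrix Q"
  shows "transpose Q ** Q = mat 1" "Q ** transpose Q = mat 1"
    "X ** transpose Q ** Q = X" "X ** Q ** transpose Q = X"
  using assms by (simp_all add: orthogonal_matrix_def flip: matrix_mul_assoc)

text \<open>Cyclicity of the trace moves the conjugation to the other factor.\<close>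

lemma inner_conj:
  fixes Q X Y :: "real ^ 'n ^ 'n"
  shows "(Q ** X ** transpose Q) \<bullet> Y = X \<bullet> (transpose Q ** Y ** Q)"
  by (simp add: inner_matrix_eq_trace matrix_transpose_mul matrix_mul_assoc)
     (metis matrix_mul_assoc trace_mul_sym)

lemma trace_orthogonal_conj:
  fixes Q X :: "real ^ 'n ^ 'n"
  assumes "orthogonal_matrix Q"
  shows "trace (Q ** X ** transpose Q) = trace X"
  using assms by (metis matrix_mul_assoc matrix_mul_rid orthogonal_matrix_def trace_mul_sym)

lemma diag_mat_mult: "diag_mat a ** diag_mat b = diag_mat (\<lambda>i. a i * b i)"
  for a b :: "'n::finite \<Rightarrow> 'a::semiring_1"
  by (simp add: vec_eq_iff matrix_matrix_mult_def diag_mat_def if_distrib [of "\<lambda>x. x * _"] cong: if_cong)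

lemma inner_diag_mat: "diag_mat e \<bullet> X = (\<Sum>i\<in>UNIV. e i * X $ i $ i)"
  for X :: "real ^ 'n ^ 'n"
  by (simp add: inner_vec_def diag_mat_def if_distrib [of "\<lambda>x. x * _"] cong: if_cong)

section \<open>Orthogonal projections as conjugated coordinate projections\<close>

lemma trace_diag_indicator: "trace (diag_mat (indicat_real I)) = card I"
  by (simp add: trace_def diag_mat_def indicator_def)

lemma rank_diag_indicator: "rank (diag_mat (indicat_real I)) = card I"
proof -
  have "(diag_mat (indicat_real I) *v x) $ i = indicat_real I i * x $ i" for x i
    by (simp add: matrix_vector_mult_def diag_mat_def if_distrib [of "\<lambda>x. x * _"] cong: if_cong)
  then have "range ((*v) (diag_mat (indicat_real I))) = {x. \<forall>i. i \<notin> I \<longrightarrow> x $ i = 0}"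
    by (force simp: image_iff vec_eq_iff indicator_def split: if_splits)
  then show ?thesis
    by (simp add: rank_dim_range dim_substandard_cart flip: dim_vec_eq)
qed

text \<open>Multiplication cannot raise the rank, and conjugating with \<open>transpose Q\<close>
  undoes the conjugation with \<open>Q\<close>.\<close>

lemma rank_orthogonal_conj:
  fixes Q X :: "real ^ 'n ^ 'n"
  assumes "orthogonal_matrix Q"
  shows "rank (Q ** X ** transpose Q) = rank X"
proof (rule antisym)
  have le: "rank (R ** Y ** transpose R) \<le> rank Y" for R Y :: "real ^ 'n ^ 'n"
    by (meson order_trans rank_mul_le_left rank_mul_le_right)
  show "rank (Q ** X ** transpose Q) \<le> rank X" by (rule le)
  have "X = transpose Q ** (Q ** X ** transpose Q) ** transpose (transpose Q)"
    using assms by (simp add: matrix_mul_assoc orthogonal_matrix_cancel)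
  then show "rank X \<le> rank (Q ** X ** transpose Q)"
    by (metis le)
qed

lemma conj_indicator_in_grassmannian:
  fixes Q :: "real ^ 'n ^ 'n"
  assumes Q: "orthogonal_matrix Q"
  shows "Q ** diag_mat (indicat_real I) ** transpose Q \<in> grassmannian (card I)"
proof -
  let ?D = "diag_mat (indicat_real I)"
  have "?D ** ?D = ?D"
    by (simp add: diag_mat_mult flip: indicator_inter_arith)
  then have "(Q ** ?D ** transpose Q) ** (Q ** ?D ** transpose Q) = Q ** ?D ** transpose Q"
    using Q by (metis matrix_mul_assoc orthogonal_matrix_cancel(3))
  then show ?thesis
    unfolding grassmannian_def
    by (simp add: rank_orthogonal_conj Q rank_diag_indicator transpose_diag_conj)
qed

text \<open>Idempotence forces every eigenvalue of \<open>P\<close> to be 0 or 1, and the rank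
  counts the ones.\<close>

lemma grassmannian_eq_conj_indicator:
  fixes P :: "real ^ 'n ^ 'n"
  assumes "P \<in> grassmannian d"
  obtains Q I where "orthogonal_matrix Q" "card I = d" "P = Q ** diag_mat (indicat_real I) ** transpose Q"
proof -
  have P: "P ** P = P" "transpose P = P" "rank P = d" using assms by (auto simp: grassmannian_def)
  obtain Q e where Q: "orthogonal_matrix Q" and PQ: "P = Q ** diag_mat e ** transpose Q"
    using symmetric_matrix_diagonalization[OF P(2)] .
  have D: "diag_mat e = transpose Q ** P ** Q"
    using Q by (simp add: PQ matrix_mul_assoc orthogonal_matrix_cancel)
  then have "diag_mat e ** diag_mat e = diag_mat e"
    using Q P(1) by (metis matrix_mul_assoc orthogonal_matrix_cancel(4))
  then have ee: "e i * e i = e i" for i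
    by (simp add: diag_mat_mult) (simp add: diag_mat_def vec_eq_iff split: if_splits)
  define I where "I = {i. e i = 1}"
  have "e i = indicat_real I i" for i
    using ee[of i] by (auto simp: I_def indicator_def)
  then have e: "e = indicat_real I" ..
  have "card I = d"
    using P(3) unfolding PQ e rank_orthogonal_conj[OF Q] rank_diag_indicator .
  from that[OF Q this PQ[unfolded e]] show thesis .
qed

lemma trace_grassmannian: "P \<in> grassmannian d \<Longrightarrow> trace P = d"
  by (metis grassmannian_eq_conj_indicator trace_diag_indicator trace_orthogonal_conj)

lemma conj_in_grassmannian:
  fixes Q :: "real ^ 'n ^ 'n"
  assumes Q: "orthogonal_matrix Q" and P: "P \<in> grassmannian d"
  shows "transpose Q ** P ** Q \<in> grassmannian d"
proof -
  obtain R I where R: "orthogonal_matrix R" "card I = d" "P = R ** diag_mat (indicat_real I) ** transpose R"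
    using grassmannian_eq_conj_indicator[OF P] .
  have "orthogonal_matrix (transpose Q ** R)"
    using Q R by (simp add: orthogonal_matrix_mul)
  from conj_indicator_in_grassmannian[OF this, of I] show ?thesis
    by (simp add: R matrix_transpose_mul matrix_mul_assoc)
qed

text \<open>By idempotence and symmetry a diagonal entry is the squared norm of its row. The row
  contains that entry, so its square is at most itself.\<close>

lemma grassmannian_diagonal:
  assumes "P \<in> grassmannian d"
  shows "P $ i $ i = (\<Sum>j\<in>UNIV. (P $ i $ j)\<^sup>2)" "0 \<le> P $ i $ i" "P $ i $ i \<le> 1"
proof -
  have P: "P ** P = P" "transpose P = P" using assms by (auto simp: grassmannian_def)
  have "P $ i $ i = (\<Sum>j\<in>UNIV. P $ i $ j * P $ j $ i)"
    using arg_cong[OF P(1), of "\<lambda>X. X $ i $ i"] by (simp add: matrix_matrix_mult_def)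
  also have "\<dots> = (\<Sum>j\<in>UNIV. (P $ i $ j)\<^sup>2)"
  proof (rule sum.cong)
    fix j
    have "P $ j $ i = P $ i $ j"
      using arg_cong[OF P(2), of "\<lambda>X. X $ i $ j"] by (simp add: transpose_def)
    then show "P $ i $ j * P $ j $ i = (P $ i $ j)\<^sup>2" by (simp add: power2_eq_square)
  qed simp
  finally show *: "P $ i $ i = (\<Sum>j\<in>UNIV. (P $ i $ j)\<^sup>2)" .
  show "0 \<le> P $ i $ i" unfolding * by (simp add: sum_nonneg)
  have le: "(P $ i $ i)\<^sup>2 \<le> P $ i $ i"
    by (subst (2) *) (rule member_le_sum, auto)
  show "P $ i $ i \<le> 1"
  proof (rule ccontr)
    assume "\<not> P $ i $ i \<le> 1"
    then have "P $ i $ i * 1 < P $ i $ i * P $ i $ i"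
      by (intro mult_strict_left_mono) auto
    with le show False by (simp add: power2_eq_square)
  qed
qed

text \<open>A diagonal entry 0 or 1 equals its own square, which already exhausts the squared norm
  of the row and leaves 0 off the diagonal.\<close>

lemma grassmannian_eq_diag_indicator:
  assumes P: "P \<in> grassmannian d" and diag: "\<And>i. P $ i $ i = indicat_real I i"
  shows "P = diag_mat (indicat_real I)"
proof -
  have "P $ i $ j = 0" if "i \<noteq> j" for i j
  proof -
    have "P $ i $ i = (P $ i $ i)\<^sup>2 + (\<Sum>j\<in>UNIV-{i}. (P $ i $ j)\<^sup>2)"
      by (subst grassmannian_diagonal(1)[OF P]) (simp add: sum.remove[of UNIV i])
    moreover have "P $ i $ i = (P $ i $ i)\<^sup>2" by (simp add: diag indicator_def)
    ultimately have "(\<Sum>j\<in>UNIV-{i}. (P $ i $ j)\<^sup>2) = 0" by linarith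
    then show ?thesis using that by (simp add: sum_nonneg_eq_0_iff)
  qed
  with diag show ?thesis by (auto simp: vec_eq_iff diag_mat_def)
qed

section \<open>Nearest points as maximisers of a linear functional\<close>

lemma dist_grassmannian_sq:
  assumes P: "P \<in> grassmannian d"
  shows "(dist A P)\<^sup>2 = A \<bullet> A - 2 * (sym_part A \<bullet> P) + d"
proof -
  \<comment> \<open>Here \<open>transpose P ** P = P\<close>, so the squared norm of
    \<open>P\<close> is its trace.\<close>
  have "P \<bullet> P = d" and "transpose P = P"
    using P trace_grassmannian[OF P] by (auto simp: inner_matrix_eq_trace grassmannian_def)
  then show ?thesis
    by (simp add: dist_norm power2_norm_eq_inner inner_diff_left inner_diff_right inner_commute[of P A] inner_sym_part)
qed

text \<open>Ky Fan's maximum principle.\<close>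

lemma inner_grassmannian_le:
  fixes Q :: "real ^ 'n ^ 'n"
  assumes Q: "orthogonal_matrix Q" and S: "S = Q ** diag_mat e ** transpose Q"
    and P: "P \<in> grassmannian (card I)"
    and ge: "\<And>i. i \<in> I \<Longrightarrow> c \<le> e i" and le: "\<And>i. i \<notin> I \<Longrightarrow> e i \<le> c"
  shows "S \<bullet> P \<le> S \<bullet> (Q ** diag_mat (indicat_real I) ** transpose Q)"
    and "S \<bullet> P = S \<bullet> (Q ** diag_mat (indicat_real I) ** transpose Q) \<Longrightarrow> (\<And>i. e i \<noteq> c) \<Longrightarrow>
      P = Q ** diag_mat (indicat_real I) ** transpose Q"
proof -
  define R where "R = transpose Q ** P ** Q"
  have R: "R \<in> grassmannian (card I)"
    unfolding R_def using conj_in_grassmannian[OF Q P] .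
  note Rd = grassmannian_diagonal[OF R]
  have tr: "(\<Sum>i\<in>UNIV. R $ i $ i) = card I"
    using trace_grassmannian[OF R] by (simp add: trace_def)
  have "S \<bullet> (Q ** diag_mat (indicat_real I) ** transpose Q) = (\<Sum>i\<in>UNIV. e i * indicat_real I i)"
    unfolding S inner_conj inner_diag_mat using Q
    by (simp add: matrix_mul_assoc orthogonal_matrix_cancel) (simp add: diag_mat_def)
  moreover have "S \<bullet> P = (\<Sum>i\<in>UNIV. e i * R $ i $ i)"
    unfolding S inner_conj inner_diag_mat R_def ..
  \<comment> \<open>Both diagonals sum to \<open>card I\<close>, so subtracting the constant
    \<open>c\<close> from every \<open>e i\<close> does not change the difference.\<close>
  moreover have "(\<Sum>i\<in>UNIV. (e i - c) * (indicat_real I i - R $ i $ i))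
     = (\<Sum>i\<in>UNIV. e i * indicat_real I i) - (\<Sum>i\<in>UNIV. e i * R $ i $ i)"
  proof -
    have "(\<Sum>i\<in>UNIV. indicat_real I i - R $ i $ i) = 0"
      by (simp add: sum_subtractf tr) (simp add: indicator_def)
    then have "(\<Sum>i\<in>UNIV. c * (indicat_real I i - R $ i $ i)) = 0"
      by (simp flip: sum_distrib_left)
    then show ?thesis
      by (simp add: left_diff_distrib right_diff_distrib sum_subtractf)
  qed
  ultimately have gap: "S \<bullet> (Q ** diag_mat (indicat_real I) ** transpose Q) - S \<bullet> P
    = (\<Sum>i\<in>UNIV. (e i - c) * (indicat_real I i - R $ i $ i))" by simp
  \<comment> \<open>On \<open>I\<close> both factors are nonnegative and off \<open>I\<close> both
    are nonpositive, since \<open>R $ i $ i\<close> lies in [0, 1].\<close>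
  have nonneg: "0 \<le> (e i - c) * (indicat_real I i - R $ i $ i)" for i
    using ge[of i] le[of i] Rd(2)[of i] Rd(3)[of i]
    by (cases "i \<in> I") (auto intro: mult_nonneg_nonneg mult_nonpos_nonneg)
  then show "S \<bullet> P \<le> S \<bullet> (Q ** diag_mat (indicat_real I) ** transpose Q)"
    using gap sum_nonneg[of UNIV "\<lambda>i. (e i - c) * (indicat_real I i - R $ i $ i)"] by simp
  assume "S \<bullet> P = S \<bullet> (Q ** diag_mat (indicat_real I) ** transpose Q)" and strict: "\<And>i. e i \<noteq> c"
  then have "(\<Sum>i\<in>UNIV. (e i - c) * (indicat_real I i - R $ i $ i)) = 0" using gap by simp
  \<comment> \<open>A vanishing sum of nonnegative terms vanishes termwise, and
    \<open>e i - c\<close> is not 0.\<close>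
  then have "R $ i $ i = indicat_real I i" for i
    using strict[of i] nonneg by (simp add: sum_nonneg_eq_0_iff) metis
  then have "R = diag_mat (indicat_real I)" by (rule grassmannian_eq_diag_indicator[OF R])
  then show "P = Q ** diag_mat (indicat_real I) ** transpose Q"
    using Q unfolding R_def by (metis matrix_mul_assoc matrix_mul_lid matrix_mul_rid orthogonal_matrix_def)
qed

lemma infdist_eq_dist_iff:
  assumes "p \<in> S"
  shows "dist a p = infdist a S \<longleftrightarrow> (\<forall>q\<in>S. dist a p \<le> dist a q)"
proof
  assume "\<forall>q\<in>S. dist a p \<le> dist a q"
  then have "dist a p \<le> infdist a S"
    using assms by (subst infdist_notempty) (auto intro: cINF_greatest)
  with infdist_le[OF assms, of a] show "dist a p = infdist a S" by simp
qed (auto intro: infdist_le)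

lemma nearest_grassmannian_iff:
  assumes P: "P \<in> grassmannian d"
  shows "dist A P = infdist A (grassmannian d)
    \<longleftrightarrow> (\<forall>R\<in>grassmannian d. sym_part A \<bullet> R \<le> sym_part A \<bullet> P)"
proof -
  have "dist A P \<le> dist A R \<longleftrightarrow> sym_part A \<bullet> R \<le> sym_part A \<bullet> P" if "R \<in> grassmannian d" for R
    using dist_grassmannian_sq[OF P, of A] dist_grassmannian_sq[OF that, of A]
    by (simp flip: power_mono_iff[of "dist A P" "dist A R" 2])
  then show ?thesis by (simp add: infdist_eq_dist_iff[OF P])
qed

text \<open>The set \<open>I\<close> stays free: with ties at \<open>c\<close> several sets separate
  the eigenvalues, and each gives a nearest point. This produces points of the medial axis.\<close>

lemma nearest_grassmannian_of_diagonalization: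
  fixes A Q :: "real ^ 'n ^ 'n"
  assumes Q: "orthogonal_matrix Q" and S: "sym_part A = Q ** diag_mat e ** transpose Q"
    and ge: "\<And>i. i \<in> I \<Longrightarrow> c \<le> e i" and le: "\<And>i. i \<notin> I \<Longrightarrow> e i \<le> c"
  defines "P \<equiv> Q ** diag_mat (indicat_real I) ** transpose Q"
  shows "P \<in> grassmannian (card I)" "dist A P = infdist A (grassmannian (card I))"
    and "(\<And>i. e i \<noteq> c) \<Longrightarrow> R \<in> grassmannian (card I) \<Longrightarrow>
      dist A R = infdist A (grassmannian (card I)) \<Longrightarrow> R = P"
proof -
  show P: "P \<in> grassmannian (card I)"
    unfolding P_def using Q by (rule conj_indicator_in_grassmannian)
  have max: "sym_part A \<bullet> R \<le> sym_part A \<bullet> P" if "R \<in> grassmannian (card I)" for R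
    unfolding P_def using inner_grassmannian_le(1)[OF Q S that ge le] .
  then show "dist A P = infdist A (grassmannian (card I))"
    by (simp add: nearest_grassmannian_iff[OF P])
  assume strict: "\<And>i. e i \<noteq> c" and R: "R \<in> grassmannian (card I)"
    and "dist A R = infdist A (grassmannian (card I))"
  then have "sym_part A \<bullet> R = sym_part A \<bullet> P"
    using max[OF R] P by (simp add: nearest_grassmannian_iff[OF R] antisym)
  then show "R = P"
    unfolding P_def using inner_grassmannian_le(2)[OF Q S R ge le] strict by blast
qed

section \<open>Stability of the eigenvalue gap\<close>

lemma subspaces_common_unit_vector:
  fixes U V :: "'a::euclidean_space set"
  assumes "subspace U" "subspace V" "DIM('a) < dim U + dim V"
  obtains x where "x \<in> U" "x \<in> V" "norm x = 1"
proof -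
  \<comment> \<open>The sum of \<open>U\<close> and \<open>V\<close> has at most the dimension of
    the space, so the dimension formula leaves a nonzero intersection.\<close>
  have "dim {x + y |x y. x \<in> U \<and> y \<in> V} \<le> DIM('a)"
    by (rule dim_subset_UNIV)
  then have "dim (U \<inter> V) > 0"
    using dim_sums_Int[OF assms(1,2)] assms(3) by linarith
  then have "\<not> U \<inter> V \<subseteq> {0}"
    by (metis dim_eq_0 less_irrefl)
  then obtain z where z: "z \<in> U" "z \<in> V" "z \<noteq> 0" by blast
  show thesis
    by (rule that[of "z /\<^sub>R norm z"]) (use z assms in \<open>auto simp: subspace_scale\<close>)
qed

text \<open>For orthogonal \<open>Q\<close> this is the span of the columns with index in
  \<open>K\<close>, described by the vanishing of the other coordinates.\<close>

definition coord_subspace :: "real ^ 'n ^ 'n \<Rightarrow> 'n set \<Rightarrow> (real ^ 'n) set" where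
  "coord_subspace Q K = {x. \<forall>i. i \<notin> K \<longrightarrow> (transpose Q *v x) $ i = 0}"

lemma subspace_coord_subspace: "subspace (coord_subspace Q K)"
  by (auto simp: coord_subspace_def subspace_def matrix_vector_right_distrib matrix_vector_mult_scaleR
      simp del: transpose_matrix_vector)

lemma dim_coord_subspace:
  assumes Q: "orthogonal_matrix Q"
  shows "dim (coord_subspace Q K) = card K"
proof -
  let ?E = "{y :: real ^ 'a. \<forall>i. i \<notin> K \<longrightarrow> y $ i = 0}"
  have inv: "transpose Q *v (Q *v y) = y" "Q *v (transpose Q *v y) = y" for y
    using Q by (simp_all add: matrix_vector_mul_assoc orthogonal_matrix_def del: transpose_matrix_vector)
  have "coord_subspace Q K = (*v) Q ` ?E"
  proof (intro equalityI subsetI)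
    fix x assume "x \<in> coord_subspace Q K"
    then show "x \<in> (*v) Q ` ?E"
      by (intro image_eqI[of _ _ "transpose Q *v x"]) (auto simp: coord_subspace_def inv simp del: transpose_matrix_vector)
  qed (auto simp: coord_subspace_def inv simp del: transpose_matrix_vector)
  moreover have "inj ((*v) Q)" by (metis inv(1) injI)
  ultimately have "dim (coord_subspace Q K) = dim ?E"
    using dim_image_eq[of "(*v) Q" ?E] by (simp add: inj_on_subset)
  then show ?thesis by (simp add: dim_substandard_cart flip: dim_vec_eq)
qed

lemma inner_transpose_mult:
  fixes Q :: "real ^ 'n ^ 'n"
  assumes "orthogonal_matrix Q"
  shows "(transpose Q *v x) \<bullet> (transpose Q *v y) = x \<bullet> y"
  by (metis assms dot_lmul_matrix matrix_vector_mul_assoc matrix_vector_mul_lid orthogonal_matrix_def transpose_matrix_vector)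

lemma inner_diag_conj:
  fixes Q :: "real ^ 'n ^ 'n"
  shows "x \<bullet> ((Q ** diag_mat e ** transpose Q) *v x) = (\<Sum>i\<in>UNIV. e i * ((transpose Q *v x) $ i)\<^sup>2)"
proof -
  have "x \<bullet> ((Q ** diag_mat e ** transpose Q) *v x) = (transpose Q *v x) \<bullet> (diag_mat e *v (transpose Q *v x))"
    by (simp add: dot_lmul_matrix flip: matrix_vector_mul_assoc)
  moreover have "(diag_mat e *v y) $ i = e i * y $ i" for y i
    by (simp add: matrix_vector_mult_def diag_mat_def if_distrib [of "\<lambda>x. x * _"] cong: if_cong)
  ultimately show ?thesis
    by (simp add: inner_vec_def power2_eq_square mult_ac)
qed

text \<open>The value of the form is a weighted mean of the \<open>e i\<close> with \<open>i\<close>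
  in \<open>K\<close>; the weights are the squared coordinates of the unit vector
  \<open>x\<close>.\<close>

lemma coord_subspace_form_ge:
  fixes Q :: "real ^ 'n ^ 'n"
  assumes Q: "orthogonal_matrix Q" and x: "x \<in> coord_subspace Q K" "norm x = 1"
    and c: "\<And>i. i \<in> K \<Longrightarrow> c \<le> e i"
  shows "c \<le> x \<bullet> ((Q ** diag_mat e ** transpose Q) *v x)"
proof -
  have "c = (\<Sum>i\<in>UNIV. c * ((transpose Q *v x) $ i)\<^sup>2)"
    using inner_transpose_mult[OF Q, of x x] x(2)
    by (simp add: dot_square_norm[of x])
       (simp add: inner_vec_def power2_eq_square flip: sum_distrib_left)
  also have "\<dots> \<le> (\<Sum>i\<in>UNIV. e i * ((transpose Q *v x) $ i)\<^sup>2)"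
  proof (rule sum_mono)
    fix i
    show "c * ((transpose Q *v x) $ i)\<^sup>2 \<le> e i * ((transpose Q *v x) $ i)\<^sup>2"
      using x(1) c[of i] by (cases "i \<in> K") (auto simp: coord_subspace_def mult_right_mono)
  qed
  finally show ?thesis by (simp add: inner_diag_conj)
qed

lemma coord_subspace_form_le:
  fixes Q :: "real ^ 'n ^ 'n"
  assumes Q: "orthogonal_matrix Q" and x: "x \<in> coord_subspace Q K" "norm x = 1"
    and c: "\<And>i. i \<in> K \<Longrightarrow> e i \<le> c"
  shows "x \<bullet> ((Q ** diag_mat e ** transpose Q) *v x) \<le> c"
  using coord_subspace_form_ge[OF Q x, of "- c" "\<lambda>i. - e i"] c
  by (simp add: inner_diag_conj sum_negf)

text \<open>For a unit vector this is the orthogonal projection onto its line; it turns values of a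
  quadratic form into inner products of matrices.\<close>

definition outer :: "real ^ 'n \<Rightarrow> real ^ 'n ^ 'n" where
  "outer u = (\<chi> i j. u $ i * u $ j)"

lemma inner_outer: "M \<bullet> outer u = u \<bullet> (M *v u)"
  by (simp add: outer_def inner_vec_def matrix_vector_mult_def sum_distrib_left mult_ac)

lemma outer_inner_outer: "outer u \<bullet> outer v = (u \<bullet> v)\<^sup>2"
proof -
  have "outer u *v v = (u \<bullet> v) *\<^sub>R u"
    by (simp add: vec_eq_iff outer_def inner_vec_def matrix_vector_mult_def sum_distrib_left mult_ac)
  then show ?thesis by (simp add: inner_outer power2_eq_square inner_commute)
qed

lemma transpose_outer: "transpose (outer u) = outer u"
  by (simp add: outer_def transpose_def vec_eq_iff mult.commute)

section \<open>The Lipschitz estimate for the eigenvalue gap\<close>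

lemma form_gap_le:
  fixes A B :: "real ^ 'n ^ 'n"
  assumes u: "norm u = 1" and v: "norm v = 1" and orth: "u \<bullet> v = 0"
  shows "u \<bullet> (sym_part A *v u) - u \<bullet> (sym_part B *v u)
      - (v \<bullet> (sym_part A *v v) - v \<bullet> (sym_part B *v v)) \<le> sqrt 2 * dist A B"
proof -
  have "u \<bullet> u = 1" "v \<bullet> v = 1"
    using u v by (simp_all add: dot_square_norm)
  then have "(norm (outer u - outer v))\<^sup>2 = 2"
    unfolding power2_norm_eq_inner inner_diff_left inner_diff_right outer_inner_outer
    using orth by (simp add: inner_commute[of v u])
  then have n: "norm (outer u - outer v) = sqrt 2"
    by (metis norm_ge_zero real_sqrt_unique)
  \<comment> \<open>Outer products are symmetric, so \<open>A\<close> and \<open>B\<close> may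
    replace their symmetric parts.\<close>
  have "u \<bullet> (sym_part A *v u) - u \<bullet> (sym_part B *v u)
      - (v \<bullet> (sym_part A *v v) - v \<bullet> (sym_part B *v v)) = (A - B) \<bullet> (outer u - outer v)"
    by (simp add: inner_sym_part transpose_outer inner_diff_left inner_diff_right flip: inner_outer)
  also have "\<dots> \<le> norm (A - B) * norm (outer u - outer v)"
    by (rule norm_cauchy_schwarz)
  finally show ?thesis by (simp add: n dist_norm mult.commute)
qed

text \<open>
  As in the Courant--Fischer theorem, dimension counting yields a unit vector \<open>u\<close> on which the form
  of \<open>A\<close> is at least its \<open>d\<close>-th eigenvalue and that of \<open>B\<close> at most its \<open>d\<close>-th eigenvalue, and
  likewise \<open>v\<close> with the inequalities reversed for the eigenvalues of index \<open>d + 1\<close>.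
\<close>

lemma eigval_gap_lipschitz:
  fixes A B :: "real ^ 'm::{finite,linorder} ^ 'm::{finite,linorder}"
  assumes d: "1 \<le> d" "d < CARD('m)"
  shows "(eigval (sym_part A) d - eigval (sym_part A) (d + 1))
      - (eigval (sym_part B) d - eigval (sym_part B) (d + 1)) \<le> sqrt 2 * dist A B"
proof -
  let ?S = "sym_part A" and ?T = "sym_part B"
  obtain Q where Q: "orthogonal_matrix Q" and S: "?S = Q ** eigval_diag ?S ** transpose Q"
    using symmetric_matrix_eigval_diagonalization[OF transpose_sym_part] .
  obtain R where R: "orthogonal_matrix R" and T: "?T = R ** eigval_diag ?T ** transpose R"
    using symmetric_matrix_eigval_diagonalization[OF transpose_sym_part] .
  note S = S[unfolded eigval_diag_eq] and T = T[unfolded eigval_diag_eq]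
  let ?K = "\<lambda>a b. {i :: 'm. pos i \<in> {a..b}}"
  have card: "card (?K a b) = b + 1 - a" if "1 \<le> a" "b \<le> CARD('m)" for a b
    by (subst card_pos_vimage) (use that in auto)
  have common: "\<exists>x. x \<in> coord_subspace Q K \<and> x \<in> coord_subspace R L \<and> norm x = 1"
    if "CARD('m) < card K + card L" for K L
    using subspaces_common_unit_vector[of "coord_subspace Q K" "coord_subspace R L"] that
    by (auto simp: subspace_coord_subspace dim_coord_subspace Q R)
  \<comment> \<open>The dimensions are \<open>d\<close> and \<open>m - d + 1\<close>, one more than
    \<open>m\<close> in total; for \<open>v\<close> below they are \<open>m - d\<close> and
    \<open>d + 1\<close>.\<close>
  have ucard: "CARD('m) < card (?K 1 d) + card (?K d (CARD('m)))"
    using card[of 1 d] card[of d "CARD('m)"] d by simp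
  have vcard: "CARD('m) < card (?K (d + 1) (CARD('m))) + card (?K 1 (d + 1))"
    using card[of "d + 1" "CARD('m)"] card[of 1 "d + 1"] d by simp
  obtain u where u: "u \<in> coord_subspace Q (?K 1 d)" "u \<in> coord_subspace R (?K d (CARD('m)))" "norm u = 1"
    using common[of "?K 1 d" "?K d (CARD('m))", OF ucard] by blast
  obtain v where v: "v \<in> coord_subspace Q (?K (d + 1) (CARD('m)))" "v \<in> coord_subspace R (?K 1 (d + 1))" "norm v = 1"
    using common[of "?K (d + 1) (CARD('m))" "?K 1 (d + 1)", OF vcard] by blast
  \<comment> \<open>In the eigenbasis \<open>Q\<close> of \<open>A\<close>, \<open>u\<close> is
    supported on positions up to \<open>d\<close> and \<open>v\<close> on later ones.\<close>
  have "u \<bullet> v = (transpose Q *v u) \<bullet> (transpose Q *v v)"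
    by (rule inner_transpose_mult[OF Q, symmetric])
  also have "\<dots> = (\<Sum>i\<in>(UNIV :: 'm set). 0)"
    unfolding inner_vec_def
  proof (rule sum.cong)
    fix i
    show "(transpose Q *v u) $ i \<bullet> (transpose Q *v v) $ i = 0"
      using u(1) v(1) pos_bounds[of i] by (cases "pos i \<le> d") (auto simp: coord_subspace_def)
  qed simp
  finally have orth: "u \<bullet> v = 0" by simp
  have "eigval ?S d \<le> u \<bullet> (?S *v u)"
    by (subst S, rule coord_subspace_form_ge[OF Q u(1,3)])
       (use d in \<open>auto intro!: eigval_antimono transpose_sym_part\<close>)
  moreover have "u \<bullet> (?T *v u) \<le> eigval ?T d"
    by (subst T, rule coord_subspace_form_le[OF R u(2,3)])
       (use d in \<open>auto intro!: eigval_antimono transpose_sym_part\<close>)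
  moreover have "v \<bullet> (?S *v v) \<le> eigval ?S (d + 1)"
    by (subst S, rule coord_subspace_form_le[OF Q v(1,3)])
       (use d in \<open>auto intro!: eigval_antimono transpose_sym_part\<close>)
  moreover have "eigval ?T (d + 1) \<le> v \<bullet> (?T *v v)"
    by (subst T, rule coord_subspace_form_ge[OF R v(2,3)])
       (use d in \<open>auto intro!: eigval_antimono transpose_sym_part\<close>)
  ultimately show ?thesis
    using form_gap_le[OF u(3) v(3) orth, of A B] by linarith
qed

section \<open>The medial axis\<close>

lemma nearest_grassmannian_unique:
  fixes A :: "real ^ 'm::{finite,linorder} ^ 'm::{finite,linorder}"
  assumes d: "1 \<le> d" "d < CARD('m)" and gap: "eigval (sym_part A) (d + 1) < eigval (sym_part A) d"
    and Q: "orthogonal_matrix Q" and S: "sym_part A = Q ** eigval_diag (sym_part A) ** transpose Q"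
  shows "P \<in> grassmannian d \<and> dist A P = infdist A (grassmannian d)
    \<longleftrightarrow> P = Q ** J_mat d ** transpose Q"
proof -
  let ?e = "\<lambda>i :: 'm. eigval (sym_part A) (pos i)"
  \<comment> \<open>The midpoint of the gap is not an eigenvalue and strictly separates the first
    \<open>d\<close> eigenvalues from the others.\<close>
  define c where "c = (eigval (sym_part A) d + eigval (sym_part A) (d + 1)) / 2"
  have card: "card {i :: 'm. pos i \<le> d} = d"
    using card_pos_le[where 'm = 'm] d by simp
  have ge: "c < ?e i" if "pos i \<le> d" for i
    using eigval_antimono[OF transpose_sym_part[of A] pos_bounds(1)[of i] that] d gap by (simp add: c_def)
  have le: "?e i < c" if "\<not> pos i \<le> d" for i
    using eigval_antimono[OF transpose_sym_part[of A] _ _ pos_bounds(2)[of i], of "d + 1"] that gap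
    by (simp add: c_def not_le Suc_le_eq)
  have ne: "?e i \<noteq> c" for i using ge[of i] le[of i] by (cases "pos i \<le> d") auto
  have ge': "c \<le> ?e i" if "i \<in> {i. pos i \<le> d}" for i using ge[of i] that by simp
  have le': "?e i \<le> c" if "i \<notin> {i. pos i \<le> d}" for i using le[of i] that by simp
  note near = nearest_grassmannian_of_diagonalization[OF Q S[unfolded eigval_diag_eq],
      where I = "{i. pos i \<le> d}" and c = c, unfolded card, folded J_mat_eq, OF ge' le']
  show ?thesis
    using near ne by blast
qed

lemma eigval_eq_of_medial_axis:
  fixes A :: "real ^ 'm::{finite,linorder} ^ 'm::{finite,linorder}"
  assumes d: "1 \<le> d" "d < CARD('m)" and A: "A \<in> medial_axis (grassmannian d)"
  shows "eigval (sym_part A) d = eigval (sym_part A) (d + 1)"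
proof (rule ccontr)
  assume "eigval (sym_part A) d \<noteq> eigval (sym_part A) (d + 1)"
  then have gap: "eigval (sym_part A) (d + 1) < eigval (sym_part A) d"
    using eigval_antimono[OF transpose_sym_part[of A], of d "d + 1"] d by simp
  obtain Q where "orthogonal_matrix Q" "sym_part A = Q ** eigval_diag (sym_part A) ** transpose Q"
    using symmetric_matrix_eigval_diagonalization[OF transpose_sym_part] .
  note unique = nearest_grassmannian_unique[OF d gap this, THEN iffD1, OF conjI]
  from A obtain P P' where "P \<in> grassmannian d" "P' \<in> grassmannian d" "P \<noteq> P'"
    "dist A P = infdist A (grassmannian d)" "dist A P' = infdist A (grassmannian d)"
    unfolding medial_axis_def by blast
  then show False using unique[of P] unique[of P'] by simp
qed

lemma sym_part_add_symmetric:
  assumes "transpose X = X"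
  shows "sym_part (A + X) = sym_part A + X"
proof -
  have "transpose (A + X) = transpose A + X"
    using assms by (simp add: transpose_def vec_eq_iff)
  then show ?thesis
    by (simp add: sym_part_def vec_eq_iff field_simps)
qed

lemma diag_conj_add:
  fixes Q :: "'a::comm_semiring_1 ^ 'n ^ 'n"
  shows "Q ** diag_mat e ** transpose Q + Q ** diag_mat g ** transpose Q
    = Q ** diag_mat (\<lambda>i. e i + g i) ** transpose Q"
  by (simp add: vec_eq_iff diag_conj_nth algebra_simps sum.distrib)

lemma medial_axis_near:
  fixes A :: "real ^ 'm::{finite,linorder} ^ 'm::{finite,linorder}"
  assumes d: "1 \<le> d" "d < CARD('m)"
  obtains B where "B \<in> medial_axis (grassmannian d)"
    "dist A B = sqrt 2 / 2 * (eigval (sym_part A) d - eigval (sym_part A) (d + 1))"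
proof -
  let ?l = "eigval (sym_part A)"
  define h where "h = (?l d - ?l (d + 1)) / 2"
  define c where "c = (?l d + ?l (d + 1)) / 2"
  have h: "0 \<le> h"
    using eigval_antimono[OF transpose_sym_part[of A], of d "d + 1"] d by (simp add: h_def)
  have "d \<in> range (pos :: 'm \<Rightarrow> nat)" "d + 1 \<in> range (pos :: 'm \<Rightarrow> nat)"
    using bij_betw_pos[where 'm = 'm] d by (auto simp: bij_betw_def)
  then obtain a b :: 'm where a: "pos a = d" and b: "pos b = d + 1" by (metis imageE)
  have ab: "a \<noteq> b" using a b by auto
  \<comment> \<open>Lowers the eigenvalue at position \<open>d\<close> and raises the one at
    \<open>d + 1\<close> by half the gap, so that both become \<open>c\<close>.\<close>
  define g where "g i = (if i = a then - h else if i = b then h else 0)" for i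
  define e where "e i = ?l (pos i) + g i" for i
  define I where "I = {i :: 'm. pos i \<le> d}"
  have cardI: "card I = d"
    using card_pos_le[where 'm = 'm] d by (simp add: I_def)
  have aI: "a \<in> I" and bI: "b \<notin> I" using a b by (auto simp: I_def)
  \<comment> \<open>Since both \<open>a\<close> and \<open>b\<close> now carry the value
    \<open>c\<close>, exchanging them gives a second set separated by the threshold
    \<open>c\<close>.\<close>
  define I' where "I' = insert b (I - {a})"
  have cardI': "card I' = d"
    using aI bI cardI d by (simp add: I'_def card_insert_if)
  obtain Q where Q: "orthogonal_matrix Q" and S: "sym_part A = Q ** eigval_diag (sym_part A) ** transpose Q"
    using symmetric_matrix_eigval_diagonalization[OF transpose_sym_part] .
  define B where "B = A + Q ** diag_mat g ** transpose Q"
  have "sym_part B = sym_part A + Q ** diag_mat g ** transpose Q"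
    unfolding B_def by (intro sym_part_add_symmetric transpose_diag_conj)
  also have "sym_part A = Q ** diag_mat (\<lambda>i. ?l (pos i)) ** transpose Q"
    using S unfolding eigval_diag_eq .
  also have "\<dots> + Q ** diag_mat g ** transpose Q = Q ** diag_mat e ** transpose Q"
    unfolding diag_conj_add e_def ..
  finally have SB: "sym_part B = Q ** diag_mat e ** transpose Q" .
  have ec: "e a = c" "e b = c"
    using ab by (simp_all add: e_def g_def a b h_def c_def field_simps)
  have ge: "c \<le> e i" if "i \<in> I" for i
  proof (cases "i = a")
    case False
    have "?l d \<le> ?l (pos i)"
      using eigval_antimono[OF transpose_sym_part[of A] pos_bounds(1)[of i]] that d by (simp add: I_def)
    then show ?thesis using False that bI h by (auto simp: e_def g_def c_def h_def)
  qed (simp add: ec)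
  have le: "e i \<le> c" if "i \<notin> I" for i
  proof (cases "i = b")
    case False
    have "?l (pos i) \<le> ?l (d + 1)"
      using eigval_antimono[OF transpose_sym_part[of A] _ _ pos_bounds(2)[of i], of "d + 1"] that by (simp add: I_def)
    then show ?thesis using False that aI h by (auto simp: e_def g_def c_def h_def)
  qed (simp add: ec)
  have ge': "c \<le> e i" if "i \<in> I'" for i using ge[of i] that ec by (auto simp: I'_def)
  have le': "e i \<le> c" if "i \<notin> I'" for i using le[of i] that ec by (auto simp: I'_def)
  let ?P = "\<lambda>I. Q ** diag_mat (indicat_real I) ** transpose Q"
  have "diag_mat (indicat_real I) $ a $ a \<noteq> diag_mat (indicat_real I') $ a $ a"
    using aI ab by (simp add: diag_mat_def I'_def)
  then have ne: "diag_mat (indicat_real I) \<noteq> diag_mat (indicat_real I')" by metis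
  \<comment> \<open>Conjugating back recovers the index set, so different sets give different
    projections.\<close>
  have cancel: "transpose Q ** ?P K ** Q = diag_mat (indicat_real K)" for K
    by (simp add: matrix_mul_assoc orthogonal_matrix_cancel Q)
  have "?P I \<noteq> ?P I'"
  proof
    assume eq: "?P I = ?P I'"
    show False using cancel[of I, unfolded eq cancel[of I']] ne by simp
  qed
  moreover note nearest_grassmannian_of_diagonalization(1,2)[OF Q SB, where I = I and c = c, OF ge le]
    nearest_grassmannian_of_diagonalization(1,2)[OF Q SB, where I = I' and c = c, OF ge' le']
  ultimately have "B \<in> medial_axis (grassmannian d)"
    unfolding medial_axis_def cardI cardI' by blast
  moreover have "dist A B = sqrt 2 / 2 * (?l d - ?l (d + 1))"
  proof -
    \<comment> \<open>Orthogonal conjugation preserves the Frobenius norm, so only the two entries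
      of size \<open>h\<close> count.\<close>
    have "(dist A B)\<^sup>2 = diag_mat g \<bullet> diag_mat g"
      by (simp add: B_def dist_norm power2_norm_eq_inner inner_conj matrix_mul_assoc orthogonal_matrix_cancel Q)
    also have "\<dots> = (\<Sum>i\<in>UNIV. (g i)\<^sup>2)"
      by (simp add: inner_diag_mat power2_eq_square) (simp add: diag_mat_def)
    also have "\<dots> = (\<Sum>i\<in>{a, b}. (g i)\<^sup>2)"
      by (rule sum.mono_neutral_right) (auto simp: g_def)
    also have "\<dots> = (sqrt 2 * h)\<^sup>2"
      using ab by (simp add: g_def power_mult_distrib)
    finally have "dist A B = sqrt 2 * h" using h by simp
    then show ?thesis by (simp add: h_def)
  qed
  ultimately show thesis by (rule that)
qed

theorem lemma3p1:
  fixes A :: "real ^ 'm::{finite,linorder} ^ 'm::{finite,linorder}" and d :: nat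
  assumes "1 \<le> d" and "d \<le> CARD('m) - 1"
  shows "infdist A (medial_axis (grassmannian d))
           = sqrt 2 / 2 * \<bar>eigval (sym_part A) d - eigval (sym_part A) (d + 1)\<bar>
       \<and> (infdist A (medial_axis (grassmannian d)) > 0 \<longrightarrow>
           (\<exists>Q. orthogonal_matrix Q \<and> sym_part A = Q ** eigval_diag (sym_part A) ** transpose Q)
         \<and> (\<forall>Q. orthogonal_matrix Q
                \<and> sym_part A = Q ** eigval_diag (sym_part A) ** transpose Q
              \<longrightarrow> proj_onto A (grassmannian d) = Q ** J_mat d ** transpose Q))"
proof -
  let ?gap = "eigval (sym_part A) d - eigval (sym_part A) (d + 1)"
  have d: "1 \<le> d" "d < CARD('m)" using assms by auto
  have gap: "0 \<le> ?gap"
    using eigval_antimono[OF transpose_sym_part[of A], of d "d + 1"] d by simp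
  obtain B where B: "B \<in> medial_axis (grassmannian d)" "dist A B = sqrt 2 / 2 * ?gap"
    using medial_axis_near[OF d] .
  have "sqrt 2 / 2 * ?gap \<le> dist A C" if "C \<in> medial_axis (grassmannian d)" for C
  proof -
    \<comment> \<open>The gap of \<open>C\<close> is 0, so the Lipschitz estimate bounds the gap of
      \<open>A\<close> itself.\<close>
    have "sqrt 2 / 2 * ?gap \<le> sqrt 2 / 2 * (sqrt 2 * dist A C)"
      using eigval_gap_lipschitz[OF d, of A C] eigval_eq_of_medial_axis[OF d that]
      by (intro mult_left_mono) auto
    moreover have "sqrt 2 / 2 * (sqrt 2 * dist A C) = dist A C" by simp
    ultimately show ?thesis by (rule ord_le_eq_trans)
  qed
  \<comment> \<open>The point \<open>B\<close> attains the lower bound. It also shows that the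
    medial axis is nonempty, where \<open>infdist\<close> would default to 0.\<close>
  then have dist: "infdist A (medial_axis (grassmannian d)) = sqrt 2 / 2 * ?gap"
    using infdist_eq_dist_iff[OF B(1), of A] B(2) by metis
  have "proj_onto A (grassmannian d) = Q ** J_mat d ** transpose Q"
    if "0 < infdist A (medial_axis (grassmannian d))" "orthogonal_matrix Q" "sym_part A = Q ** eigval_diag (sym_part A) ** transpose Q" for Q
  proof -
    \<comment> \<open>Positive distance means a positive gap, so the nearest point is unique and the
      description in \<open>proj_onto\<close> is meaningful.\<close>
    have "eigval (sym_part A) (d + 1) < eigval (sym_part A) d"
      using that(1) by (simp add: dist zero_less_mult_iff)
    from nearest_grassmannian_unique[OF d this that(2,3)] show ?thesis
      by (simp add: proj_onto_def)
  qed
  then show ?thesis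
    using dist gap symmetric_matrix_eigval_diagonalization[OF transpose_sym_part[of A]] by force
qed

end
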